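(* Suppose users are homogeneous, $\theta_1=\theta_2=\theta_0$. Then individual rationality always holds at the social optimum $x_H^*$ with full participation $b=1$, and the side-payment function $$g(x_H)=\frac{x_H^*c_H(1-x_H)}{1-x_H^*}$$ incentivizes $x_H^*$ (i.e. makes $x_H^*$ a stable equilibrium, with every user's equilibrium payoff $\theta_0Q(x_H^*,1)-x_H^*c_H\ge0$). Consequently the price of anarchy under side payments is $PoA_g=1$.
   Context: A unit mass of non-atomic users of common valuation $\theta_0>0$ chooses between path $H$ (travel cost $c_H>0$) and path $L$ (cost $0$); a mass $x_H$ chooses $H$. $Q_1:[0,1]\to[0,\infty)$ is continuous, concave, nondecreasing with $Q_1(0)=0$; $Q(x,1)=Q_1(x)+Q_1(1-x)$ is strictly increasing on $[0,1/2]$. Social welfare: $SW(x)=\theta_0Q(x,1)-xc_H$; $x_H^*\in\arg\max_{0\le x\le1}SW(x)$ (then $x_H^*\in[0,1/2]$); it is assumed that $SW(x_H^* )\ge0$. Side-payment mechanism with function $g$: each $L$-user pays $g(x_H)$ and each $H$-user receives $\frac{1-x_H}{x_H}g(x_H)$ (budget balance; zero if $g\equiv0$). Payoffs: $u(L,x_H)=\theta_0Q(x_H,1)-g(x_H)$, $u(H,x_H)=\theta_0Q(x_H,1)-c_H+\frac{1-x_H}{x_H}g(x_H)$. With $D=u(H,\cdot)-u(L,\cdot)$, $\hat{x}$ is an equilibrium if $D(\hat{x})\ge0$ when $\hat{x}>0$ and $D(\hat{x})\le0$ when $\hat{x}<1$; it is stable if $D>0$ just to the left and $D<0$ just to the right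 of $\hat{x}$ (within $[0,1]$). Individual rationality (IR): every participating user has nonnegative payoff. $PoA_g$ is the infimum over all parameters and functions $Q_1$ of the ratio between the welfare at the equilibrium incentivized by the optimally designed side payment and $SW(x_H^* )$. *)

theory Defs
  imports "HOL-Analysis.Analysis"
begin

text \<open>
  A unit mass of users with common valuation \<open>\<theta>\<close> splits between path \<open>H\<close> (travel cost \<open>c\<close>) and
  path \<open>L\<close> (travel cost \<open>0\<close>); \<open>x\<close> is the mass on \<open>H\<close> and \<open>b\<close> the total participating mass.
\<close>

definition Q_total :: "(real \<Rightarrow> real) \<Rightarrow> real \<Rightarrow> real \<Rightarrow> real" where
  "Q_total Q1 x b = Q1 x + Q1 (b - x)"

definition game :: "real \<Rightarrow> real \<Rightarrow> (real \<Rightarrow> real) \<Rightarrow> bool" where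
  "game \<theta> c Q1 \<longleftrightarrow>
     0 < \<theta> \<and> 0 < c \<and>
     (\<forall>x\<in>{0..1}. 0 \<le> Q1 x) \<and> Q1 0 = 0 \<and>
     continuous_on {0..1} Q1 \<and> concave_on {0..1} Q1 \<and> mono_on {0..1} Q1 \<and>
     strict_mono_on {0..1/2} (\<lambda>x. Q_total Q1 x 1)"

definition SW :: "real \<Rightarrow> real \<Rightarrow> (real \<Rightarrow> real) \<Rightarrow> real \<Rightarrow> real" where
  "SW \<theta> c Q1 x = \<theta> * Q_total Q1 x 1 - x * c"

definition social_optimum :: "real \<Rightarrow> real \<Rightarrow> (real \<Rightarrow> real) \<Rightarrow> real \<Rightarrow> bool" where
  "social_optimum \<theta> c Q1 xs \<longleftrightarrow> is_arg_max (SW \<theta> c Q1) (\<lambda>x. 0 \<le> x \<and> x \<le> 1) xs"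

text \<open>
  A side payment \<open>g\<close> is charged to each \<open>L\<close>-user and redistributed equally among the \<open>H\<close>-users.
  The receipt is extended-real valued because of \<open>x = 0\<close>: there ereal arithmetic gives
  \<open>1 / 0 = \<infinity>\<close> and \<open>\<infinity> * 0 = 0\<close>, so a first \<open>H\<close>-user would receive \<open>\<infinity>\<close> if \<open>g 0 > 0\<close> and nothing
  if \<open>g 0 = 0\<close>, in particular if \<open>g\<close> is identically zero.  For \<open>x > 0\<close> the receipt is the real
  number \<open>(1 - x) / x * g x\<close>.
\<close>

definition receipt :: "(real \<Rightarrow> real) \<Rightarrow> real \<Rightarrow> ereal" where
  "receipt g x = ereal (1 - x) / ereal x * ereal (g x)"

definition uL :: "real \<Rightarrow> (real \<Rightarrow> real) \<Rightarrow> (real \<Rightarrow> real) \<Rightarrow> real \<Rightarrow> ereal" where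
  "uL \<theta> Q1 g x = ereal (\<theta> * Q_total Q1 x 1 - g x)"

definition uH :: "real \<Rightarrow> real \<Rightarrow> (real \<Rightarrow> real) \<Rightarrow> (real \<Rightarrow> real) \<Rightarrow> real \<Rightarrow> ereal" where
  "uH \<theta> c Q1 g x = ereal (\<theta> * Q_total Q1 x 1 - c) + receipt g x"

definition advantage :: "real \<Rightarrow> real \<Rightarrow> (real \<Rightarrow> real) \<Rightarrow> (real \<Rightarrow> real) \<Rightarrow> real \<Rightarrow> ereal" where
  "advantage \<theta> c Q1 g x = uH \<theta> c Q1 g x - uL \<theta> Q1 g x"

definition equilibrium :: "real \<Rightarrow> real \<Rightarrow> (real \<Rightarrow> real) \<Rightarrow> (real \<Rightarrow> real) \<Rightarrow> real \<Rightarrow> bool" where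
  "equilibrium \<theta> c Q1 g x \<longleftrightarrow>
     0 \<le> x \<and> x \<le> 1 \<and>
     (0 < x \<longrightarrow> 0 \<le> advantage \<theta> c Q1 g x) \<and>
     (x < 1 \<longrightarrow> advantage \<theta> c Q1 g x \<le> 0)"

text \<open>At \<open>x = 0\<close> (at \<open>x = 1\<close>) the left (right) condition is void, its filter being \<open>bot\<close>.\<close>

definition stable_equilibrium ::
    "real \<Rightarrow> real \<Rightarrow> (real \<Rightarrow> real) \<Rightarrow> (real \<Rightarrow> real) \<Rightarrow> real \<Rightarrow> bool" where
  "stable_equilibrium \<theta> c Q1 g x \<longleftrightarrow>
     equilibrium \<theta> c Q1 g x \<and>
     (\<forall>\<^sub>F y in at x within {0..<x}. 0 < advantage \<theta> c Q1 g y) \<and>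
     (\<forall>\<^sub>F y in at x within {x<..1}. advantage \<theta> c Q1 g y < 0)"

text \<open>With full participation the \<open>H\<close>- and \<open>L\<close>-users, of mass \<open>x\<close> and \<open>1 - x\<close>, are all the users.\<close>

definition individually_rational ::
    "real \<Rightarrow> real \<Rightarrow> (real \<Rightarrow> real) \<Rightarrow> (real \<Rightarrow> real) \<Rightarrow> real \<Rightarrow> bool" where
  "individually_rational \<theta> c Q1 g x \<longleftrightarrow>
     (0 < x \<longrightarrow> 0 \<le> uH \<theta> c Q1 g x) \<and> (x < 1 \<longrightarrow> 0 \<le> uL \<theta> Q1 g x)"

text \<open>
  Feasible designs incentivize some equilibrium and keep every user participating; a design that
  incentivizes several equilibria is valued by the worst of them.
\<close>

definition feasible_design :: "real \<Rightarrow> real \<Rightarrow> (real \<Rightarrow> real) \<Rightarrow> (real \<Rightarrow> real) \<Rightarrow> bool" where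
  "feasible_design \<theta> c Q1 g \<longleftrightarrow>
     (\<exists>x. stable_equilibrium \<theta> c Q1 g x) \<and>
     (\<forall>x. stable_equilibrium \<theta> c Q1 g x \<longrightarrow> individually_rational \<theta> c Q1 g x)"

definition design_welfare :: "real \<Rightarrow> real \<Rightarrow> (real \<Rightarrow> real) \<Rightarrow> (real \<Rightarrow> real) \<Rightarrow> ereal" where
  "design_welfare \<theta> c Q1 g = (INF x\<in>{x. stable_equilibrium \<theta> c Q1 g x}. ereal (SW \<theta> c Q1 x))"

definition optimal_design_welfare :: "real \<Rightarrow> real \<Rightarrow> (real \<Rightarrow> real) \<Rightarrow> ereal" where
  "optimal_design_welfare \<theta> c Q1 = (SUP g\<in>{g. feasible_design \<theta> c Q1 g}. design_welfare \<theta> c Q1 g)"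

text \<open>
  No ratio has denominator \<open>0\<close>: \<open>SW \<theta> c Q1 0 = \<theta> * Q1 1\<close>, and \<open>Q1 1 = 0\<close> would force \<open>Q1\<close> to vanish on
  \<open>{0..1}\<close>, against the strict monotonicity in \<^const>\<open>game\<close>.
\<close>

definition PoA_g :: ereal where
  "PoA_g = Inf {optimal_design_welfare \<theta> c Q1 / ereal (SW \<theta> c Q1 xs) | \<theta> c Q1 xs.
                  game \<theta> c Q1 \<and> social_optimum \<theta> c Q1 xs \<and> 0 \<le> SW \<theta> c Q1 xs}"

end

theory Submission
  imports Defs
begin

text \<open>
  For \<open>0 < x\<close> the advantage of \<open>H\<close> is \<open>g x / x - c\<close>, so an interior equilibrium forces \<open>g x = x * c\<close>, and
  then all users get \<open>\<theta> * Q - x * c\<close>, the welfare at \<open>x\<close>.  For the proposed payment \<open>g x / x\<close> decreases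
  strictly and equals \<open>c\<close> at the optimum (or, if the optimum is \<open>0\<close>, \<open>g\<close> vanishes and \<open>H\<close> is never
  attractive), so the optimum is the only equilibrium; hence the worst equilibrium of this design is
  already socially optimal.
\<close>

lemma Q_total_commute: "Q_total Q1 (1 - x) 1 = Q_total Q1 x 1"
  by (simp add: Q_total_def)

lemma social_optimum_le:
  assumes "social_optimum \<theta> c Q1 xs" "0 \<le> x" "x \<le> 1"
  shows "SW \<theta> c Q1 x \<le> SW \<theta> c Q1 xs"
  using assms unfolding social_optimum_def is_arg_max_linorder by blast

text \<open>Exchanging the two paths keeps \<open>Q_total\<close> but changes the travel cost from
  \<open>xs * c\<close> to \<open>(1 - xs) * c\<close>, so the optimum has the smaller mass on
  \<open>H\<close>. In particular \<open>1 - xs\<close> is positive.\<close>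

lemma social_optimum_bounds:
  assumes game: "game \<theta> c Q1" and opt: "social_optimum \<theta> c Q1 xs"
  shows "0 \<le> xs" "xs \<le> 1 / 2"
proof -
  have xs: "0 \<le> xs" "xs \<le> 1"
    using opt by (auto simp: social_optimum_def is_arg_max_def)
  then have "SW \<theta> c Q1 (1 - xs) \<le> SW \<theta> c Q1 xs"
    using social_optimum_le[OF opt] by simp
  then have "xs * c \<le> (1 - xs) * c"
    by (simp add: SW_def Q_total_commute)
  then show "0 \<le> xs" "xs \<le> 1 / 2"
    using xs game by (auto simp: game_def)
qed

text \<open>Comparing the masses 0 and 1/2 on \<open>H\<close> gives
  \<open>Q1 1 < 2 * Q1 (1 / 2) \<le> 2 * Q1 1\<close>.\<close>

lemma game_Q1_one_pos:
  assumes "game \<theta> c Q1"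
  shows "0 < Q1 1"
proof -
  have "Q_total Q1 0 1 < Q_total Q1 (1 / 2) 1"
    using assms unfolding game_def by (elim conjE strict_mono_onD) auto
  moreover have "Q1 (1 / 2) \<le> Q1 1"
    using assms unfolding game_def by (elim conjE mono_onD) auto
  ultimately show ?thesis
    using assms by (simp add: Q_total_def game_def)
qed

lemma SW_social_optimum_pos:
  assumes game: "game \<theta> c Q1" and opt: "social_optimum \<theta> c Q1 xs"
  shows "0 < SW \<theta> c Q1 xs"
proof -
  have "0 < \<theta> * Q1 1"
    using game game_Q1_one_pos[OF game] by (simp add: game_def)
  also have "\<dots> = SW \<theta> c Q1 0"
    using game by (simp add: SW_def Q_total_def game_def)
  also have "\<dots> \<le> SW \<theta> c Q1 xs"
    using social_optimum_le[OF opt] by simp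
  finally show ?thesis .
qed

text \<open>The \<open>Q_total\<close> terms cancel; an \<open>H\<close>-user saves
  \<open>g x\<close> and receives \<open>(1 - x) / x * g x\<close>, together
  \<open>g x / x\<close>.\<close>

lemma advantage_pos_mass:
  assumes "0 < x"
  shows "advantage \<theta> c Q1 g x = ereal (g x / x - c)"
  using assms by (simp add: advantage_def uH_def uL_def receipt_def field_simps)

lemma advantage_zero_mass:
  "advantage \<theta> c Q1 g 0 = (if g 0 = 0 then ereal (- c) else if 0 < g 0 then \<infinity> else - \<infinity>)"
proof -
  have "receipt g 0 = \<infinity> * ereal (g 0)"
    by (simp add: receipt_def divide_ereal_def one_ereal_def[symmetric])
  then show ?thesis
    by (simp add: advantage_def uH_def uL_def zero_ereal_def[symmetric])
qed

lemma equilibrium_payment: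
  assumes "equilibrium \<theta> c Q1 g x" "0 < x" "x < 1"
  shows "g x = x * c"
proof -
  have "g x / x = c"
    using assms by (auto simp: equilibrium_def advantage_pos_mass)
  then show ?thesis
    using assms by (simp add: field_simps)
qed

text \<open>An \<open>L\<close>-user pays \<open>x * c\<close>; an \<open>H\<close>-user bears the
  cost \<open>c\<close> and gets \<open>(1 - x) * c\<close> back.\<close>

lemma equilibrium_payoffs:
  assumes "equilibrium \<theta> c Q1 g x" "0 < x" "x < 1"
  shows "uL \<theta> Q1 g x = ereal (SW \<theta> c Q1 x)" "uH \<theta> c Q1 g x = ereal (SW \<theta> c Q1 x)"
  using equilibrium_payment[OF assms] assms
  by (simp_all add: uL_def uH_def receipt_def SW_def field_simps)

lemma individually_rational_at_optimum:
  assumes game: "game \<theta> c Q1" and opt: "social_optimum \<theta> c Q1 xs"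
    and SW: "0 \<le> SW \<theta> c Q1 xs" and eq: "equilibrium \<theta> c Q1 g xs"
  shows "individually_rational \<theta> c Q1 g xs"
proof (cases "xs = 0")
  case True
  \<comment> \<open>With nobody on \<open>H\<close> only \<open>uL\<close> matters, and
    \<open>g 0 > 0\<close> is excluded because the first user to switch would gain
    \<infinity>.\<close>
  have "advantage \<theta> c Q1 g 0 \<le> 0"
    using eq True by (simp add: equilibrium_def)
  then have "g 0 \<le> 0"
    by (auto simp: advantage_zero_mass split: if_splits)
  then show ?thesis
    using True SW by (simp add: individually_rational_def uL_def SW_def)
next
  case False
  then have "0 < xs" "xs < 1"
    using social_optimum_bounds[OF game opt] by auto
  then show ?thesis
    using equilibrium_payoffs[OF eq] SW by (simp add: individually_rational_def)
qed

text \<open>Proportional to \<open>1 - x\<close> and, for \<open>xs < 1\<close>, scaled to equal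
  \<open>xs * c\<close> at \<open>xs\<close>, the value forced by an interior equilibrium.\<close>

definition optimal_payment :: "real \<Rightarrow> real \<Rightarrow> real \<Rightarrow> real" where
  "optimal_payment c xs x = xs * c * (1 - x) / (1 - xs)"

lemma advantage_optimal_payment:
  assumes "0 < x" "xs < 1"
  shows "advantage \<theta> c Q1 (optimal_payment c xs) x = ereal (c * (xs - x) / (x * (1 - xs)))"
  using assms by (simp add: advantage_pos_mass optimal_payment_def field_simps)

lemma advantage_optimal_payment_pos:
  assumes "0 < c" "0 \<le> x" "x < xs" "xs < 1"
  shows "0 < advantage \<theta> c Q1 (optimal_payment c xs) x"
proof (cases "x = 0")
  \<comment> \<open>Here \<open>xs > 0\<close>, so the payment at 0 is positive and the advantage is
    \<infinity>; the quotient formula covers only positive mass.\<close>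
  case True
  then show ?thesis
    using assms by (simp add: advantage_zero_mass optimal_payment_def)
next
  case False
  then show ?thesis
    using assms by (simp add: advantage_optimal_payment)
qed

lemma advantage_optimal_payment_neg:
  assumes "0 < c" "0 \<le> xs" "xs < x" "xs < 1"
  shows "advantage \<theta> c Q1 (optimal_payment c xs) x < 0"
  using assms by (simp add: advantage_optimal_payment divide_neg_pos mult_pos_neg)

text \<open>Away from \<open>xs\<close> the worse path still has users, who would switch:
  \<open>L\<close> below \<open>xs\<close> since \<open>x < 1\<close>, and \<open>H\<close> above
  \<open>xs\<close> since \<open>0 < x\<close>.\<close>

lemma equilibrium_optimal_payment_unique:
  assumes "0 < c" "0 \<le> xs" "xs < 1" "equilibrium \<theta> c Q1 (optimal_payment c xs) x"
  shows "x = xs"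
proof (rule ccontr)
  assume "x \<noteq> xs"
  then consider "x < xs" | "xs < x" by linarith
  then show False
    using assms advantage_optimal_payment_pos[of c x xs \<theta> Q1]
      advantage_optimal_payment_neg[of c xs x \<theta> Q1]
    by cases (auto simp: equilibrium_def)
qed

lemma stable_equilibrium_optimal_payment:
  assumes "0 < c" "0 \<le> xs" "xs < 1"
  shows "stable_equilibrium \<theta> c Q1 (optimal_payment c xs) xs"
proof -
  \<comment> \<open>A negative advantage at \<open>xs = 0\<close> is harmless: nonnegativity is
    required only for positive mass.\<close>
  have "advantage \<theta> c Q1 (optimal_payment c xs) xs = (if xs = 0 then ereal (- c) else 0)"
    using assms
    by (cases "xs = 0")
      (simp_all add: advantage_optimal_payment advantage_zero_mass optimal_payment_def)
  then have "equilibrium \<theta> c Q1 (optimal_payment c xs) xs"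
    using assms by (simp add: equilibrium_def)
  moreover have "\<forall>\<^sub>F y in at xs within {0..<xs}. 0 < advantage \<theta> c Q1 (optimal_payment c xs) y"
    using assms by (auto simp: eventually_at_filter advantage_optimal_payment_pos)
  moreover have "\<forall>\<^sub>F y in at xs within {xs<..1}. advantage \<theta> c Q1 (optimal_payment c xs) y < 0"
    using assms by (auto simp: eventually_at_filter advantage_optimal_payment_neg)
  ultimately show ?thesis
    by (simp add: stable_equilibrium_def)
qed

text \<open>Feasibility supplies a stable equilibrium, and its welfare bounds the infimum; over an
  empty set the infimum would be \<infinity>.\<close>

lemma feasible_design_welfare_le:
  assumes "social_optimum \<theta> c Q1 xs" "feasible_design \<theta> c Q1 g"
  shows "design_welfare \<theta> c Q1 g \<le> ereal (SW \<theta> c Q1 xs)"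
proof -
  obtain x where x: "stable_equilibrium \<theta> c Q1 g x"
    using assms by (auto simp: feasible_design_def)
  then have "SW \<theta> c Q1 x \<le> SW \<theta> c Q1 xs"
    using social_optimum_le[OF assms(1)] by (simp add: stable_equilibrium_def equilibrium_def)
  then show ?thesis
    using x unfolding design_welfare_def by (intro INF_lower2[of x]) auto
qed

lemma optimal_design_welfare_eq:
  assumes game: "game \<theta> c Q1" and opt: "social_optimum \<theta> c Q1 xs" and SW: "0 \<le> SW \<theta> c Q1 xs"
  shows "optimal_design_welfare \<theta> c Q1 = ereal (SW \<theta> c Q1 xs)"
proof (rule antisym)
  show "optimal_design_welfare \<theta> c Q1 \<le> ereal (SW \<theta> c Q1 xs)"
    unfolding optimal_design_welfare_def
    by (intro SUP_least) (simp add: feasible_design_welfare_le[OF opt])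
  have c: "0 < c" and xs: "0 \<le> xs" "xs < 1"
    using social_optimum_bounds[OF game opt] game by (auto simp: game_def)
  let ?g = "optimal_payment c xs"
  \<comment> \<open>Uniqueness reduces both the worst case and individual rationality to the single
    point \<open>xs\<close>.\<close>
  have stable: "{x. stable_equilibrium \<theta> c Q1 ?g x} = {xs}"
    using stable_equilibrium_optimal_payment[OF c xs] equilibrium_optimal_payment_unique[OF c xs]
    by (auto simp: stable_equilibrium_def)
  then have "feasible_design \<theta> c Q1 ?g"
    using individually_rational_at_optimum[OF game opt SW]
    unfolding feasible_design_def by (auto simp: set_eq_iff stable_equilibrium_def)
  moreover have "design_welfare \<theta> c Q1 ?g = ereal (SW \<theta> c Q1 xs)"
    by (simp add: design_welfare_def stable)
  ultimately show "ereal (SW \<theta> c Q1 xs) \<le> optimal_design_welfare \<theta> c Q1"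
    unfolding optimal_design_welfare_def by (intro SUP_upper2[of ?g]) auto
qed

text \<open>Without an instance the infimum in \<^const>\<open>PoA_g\<close> would be \<open>\<infinity>\<close>.\<close>

lemma game_example:
  shows "\<exists>\<theta> c Q1 xs. game \<theta> c Q1 \<and> social_optimum \<theta> c Q1 xs \<and> 0 \<le> SW \<theta> c Q1 xs"
proof -
  \<comment> \<open>Here \<open>Q_total Q1 x 1 = 1 + 2 * x - 2 * x\<^sup>2\<close>; with valuation 1
    the cost 2 cancels the linear term, so the optimum is 0.\<close>
  define Q1 :: "real \<Rightarrow> real" where "Q1 x = 2 * x - x\<^sup>2" for x
  have SW: "SW 1 2 Q1 x = 1 - 2 * x\<^sup>2" for x
    by (simp add: SW_def Q_total_def Q1_def power2_eq_square algebra_simps)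
  have diff: "Q1 y - Q1 x = (y - x) * (2 - x - y)" for x y
    by (simp add: Q1_def power2_eq_square algebra_simps)
  have "0 \<le> Q1 x" if "x \<in> {0..1}" for x
    using diff[of x 0] that by (simp add: Q1_def)
  moreover have "continuous_on {0..1} Q1"
    unfolding Q1_def by (intro continuous_intros)
  moreover have "concave_on {0..1} Q1"
    unfolding concave_on_iff
  proof (intro conjI ballI allI impI)
    fix x y u v :: real
    assume "0 \<le> u" "0 \<le> v" "u + v = 1"
    then have u: "u = 1 - v"
      by simp
    have "Q1 (u * x + v * y) - (u * Q1 x + v * Q1 y) = u * v * (x - y)\<^sup>2"
      unfolding u by (simp add: Q1_def power2_eq_square algebra_simps)
    then show "u * Q1 x + v * Q1 y \<le> Q1 (u *\<^sub>R x + v *\<^sub>R y)"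
      using \<open>0 \<le> u\<close> \<open>0 \<le> v\<close> by (smt (verit) mult_nonneg_nonneg real_scaleR_def zero_le_power2)
  qed simp
  moreover have "mono_on {0..1} Q1"
  proof (rule mono_onI)
    fix x y :: real
    assume "x \<in> {0..1}" "y \<in> {0..1}" "x \<le> y"
    then have "0 \<le> (y - x) * (2 - x - y)"
      by (intro mult_nonneg_nonneg) auto
    then show "Q1 x \<le> Q1 y"
      using diff[of y x] by simp
  qed
  moreover have "strict_mono_on {0..1/2} (\<lambda>x. Q_total Q1 x 1)"
  proof (rule strict_mono_onI)
    fix x y :: real
    assume "x \<in> {0..1/2}" "y \<in> {0..1/2}" "x < y"
    \<comment> \<open>From \<open>x < y \<le> 1 / 2\<close> follows
      \<open>x + y < 1\<close>.\<close>
    then have "0 < 2 * ((y - x) * (1 - x - y))"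
      by (intro mult_pos_pos) auto
    also have "\<dots> = Q_total Q1 y 1 - Q_total Q1 x 1"
      by (simp add: Q_total_def Q1_def power2_eq_square algebra_simps)
    finally show "Q_total Q1 x 1 < Q_total Q1 y 1"
      by simp
  qed
  ultimately have "game 1 2 Q1"
    by (simp add: game_def Q1_def)
  moreover have "social_optimum 1 2 Q1 0"
    by (simp add: social_optimum_def is_arg_max_linorder SW)
  moreover have "0 \<le> SW 1 2 Q1 0"
    by (simp add: SW)
  ultimately show ?thesis
    by blast
qed

theorem proposition4:
  shows "(\<forall>(\<theta>::real) (c::real) (Q1::real \<Rightarrow> real) (xs::real).
            game \<theta> c Q1 \<and> social_optimum \<theta> c Q1 xs \<and> 0 \<le> SW \<theta> c Q1 xs \<longrightarrow>
              (\<forall>g. equilibrium \<theta> c Q1 g xs \<longrightarrow> individually_rational \<theta> c Q1 g xs) \<and>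
              (let g = (\<lambda>x. xs * c * (1 - x) / (1 - xs));
                   v = \<theta> * Q_total Q1 xs 1 - xs * c
               in stable_equilibrium \<theta> c Q1 g xs \<and>
                  individually_rational \<theta> c Q1 g xs \<and>
                  (0 < xs \<longrightarrow> uH \<theta> c Q1 g xs = ereal v) \<and>
                  uL \<theta> Q1 g xs = ereal v \<and>
                  0 \<le> v))
         \<and> PoA_g = 1"
proof (intro conjI allI impI)
  fix \<theta> c xs :: real and Q1 :: "real \<Rightarrow> real"
  assume "game \<theta> c Q1 \<and> social_optimum \<theta> c Q1 xs \<and> 0 \<le> SW \<theta> c Q1 xs"
  then have game: "game \<theta> c Q1" and opt: "social_optimum \<theta> c Q1 xs"
    and SW: "0 \<le> SW \<theta> c Q1 xs"
    by auto
  then have c: "0 < c" and xs: "0 \<le> xs" "xs < 1"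
    using social_optimum_bounds[OF game opt] by (auto simp: game_def)
  have payment: "(\<lambda>x. xs * c * (1 - x) / (1 - xs)) = optimal_payment c xs"
    by (simp add: fun_eq_iff optimal_payment_def)
  have eq: "equilibrium \<theta> c Q1 (optimal_payment c xs) xs"
    using stable_equilibrium_optimal_payment[OF c xs] by (simp add: stable_equilibrium_def)
  \<comment> \<open>Direct evaluation also covers \<open>xs = 0\<close>, where
    \<open>equilibrium_payoffs\<close> does not apply.\<close>
  have "uL \<theta> Q1 (optimal_payment c xs) xs = ereal (SW \<theta> c Q1 xs)"
    using xs by (simp add: uL_def SW_def optimal_payment_def)
  then show "let g = (\<lambda>x. xs * c * (1 - x) / (1 - xs));
            v = \<theta> * Q_total Q1 xs 1 - xs * c
        in stable_equilibrium \<theta> c Q1 g xs \<and> individually_rational \<theta> c Q1 g xs \<and>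
           (0 < xs \<longrightarrow> uH \<theta> c Q1 g xs = ereal v) \<and> uL \<theta> Q1 g xs = ereal v \<and> 0 \<le> v"
    unfolding Let_def payment SW_def[symmetric]
    using stable_equilibrium_optimal_payment[OF c xs] equilibrium_payoffs(2)[OF eq] xs SW
      individually_rational_at_optimum[OF game opt SW eq]
    by simp
next
  define R where "R = {optimal_design_welfare \<theta> c Q1 / ereal (SW \<theta> c Q1 xs) | \<theta> c Q1 xs.
              game \<theta> c Q1 \<and> social_optimum \<theta> c Q1 xs \<and> 0 \<le> SW \<theta> c Q1 xs}"
  \<comment> \<open>The denominator is strictly positive, so the extended-real quotient
    cancels.\<close>
  have ratio: "optimal_design_welfare \<theta> c Q1 / ereal (SW \<theta> c Q1 xs) = 1"
    if "game \<theta> c Q1" "social_optimum \<theta> c Q1 xs" "0 \<le> SW \<theta> c Q1 xs" for \<theta> c Q1 xs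
    using optimal_design_welfare_eq[OF that] SW_social_optimum_pos[OF that(1,2)]
    by simp
  have "R \<noteq> {}"
    unfolding R_def using game_example by blast
  moreover have "r = 1" if r: "r \<in> R" for r
  proof -
    obtain \<theta> c Q1 xs where "r = optimal_design_welfare \<theta> c Q1 / ereal (SW \<theta> c Q1 xs)"
      "game \<theta> c Q1" "social_optimum \<theta> c Q1 xs" "0 \<le> SW \<theta> c Q1 xs"
      using r unfolding R_def by blast
    then show "r = 1"
      using ratio by simp
  qed
  ultimately have "R = {1}"
    by blast
  then show "PoA_g = 1"
    by (simp add: PoA_g_def R_def[symmetric])
qed (use individually_rational_at_optimum in blast)

end
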